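(* Consider the zero-sum intrusion detection game with payoff matrix $A\in\mathbb{R}^{m\times n}$, $A_{ij}=\log(p_{miss}(i,j))+c_i-r_j$, whose entries lie in $[0,1]$, and let $V_A^*=\min_{x\in X}\max_{y\in Y}x^\top A y$ be its Nash equilibrium value. Let $\{x_1,\dots,x_T\}$ and $\{y_1,\dots,y_T\}$ be the mixed strategies returned by the Distributed Weighted Majority algorithm after $T\ge 1$ iterations with $$\beta=\left(1+\sqrt{\frac{2|\mathcal{S}|\ln|\Theta|}{\tilde L}}\right)^{-1},$$ where $\tilde L>0$ satisfies $\tilde L\ge \min_{i\in I}\sum_{t=1}^T\sum_{q=1}^p \ell^q_t(\theta_{k_{q,i}})$. Let $\bar x=\frac1T\sum_{t=1}^T x_t$ and $\bar y=\frac1T\sum_{t=1}^T y_t$. Then $\bar x\in X$ and $\bar y\in Y$ are valid mixed strategies, and the pair $(\bar x,\bar y)$ approximates the game's Nash equilibrium value within $\epsilon_T$, i.e. $|\bar x^\top A\bar y-V_A^*|\le \epsilon_T$, where $$\epsilon_T=\frac{\sqrt{2\tilde L|\mathcal{S}|\ln|\Theta|}}{T}+\frac{|\mathcal{S}|\ln|\Theta|}{T}.$$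
   Context: Setting. $\mathcal{S}=\{s_1,\dots,s_p\}$, $p=|\mathcal{S}|$, is a set of sensors deployed on a finite graph; each has $d=|\Theta|$ possible orientations $\Theta=\{\theta_1,\dots,\theta_d\}$, orienting $s_q$ in direction $\theta_k$ costs $c_k^q\ge 0$, and each orientation of a sensor covers a given subset of nodes. $I$ is the set of joint orientations $i=[k_{1,i},\dots,k_{p,i}]$, where $\theta_{k_{q,i}}$ is the orientation of $s_q$ in $i$; $m=|I|=|\Theta|^{|\mathcal{S}|}$ and $c_i=\sum_{q=1}^p c^q_{k_{q,i}}$. $J$ is a finite set of intruder paths, $n=|J|$, with costs $r_j\ge0$. Sensor $s_q$ has detection probability $p_{detect,q}\in[p_{min,q},p_{max,q}]$, $0<p_{min,q}<p_{max,q}<1$. $V^q_{kj}$ is the number of nodes of path $j$ covered by $s_q$ in orientation $\theta_k$, $V^q_{ij}=V^q_{k_{q,i}\,j}$ for $i\in I$, and $p_{miss}(i,j)=\prod_{q=1}^p(1-p_{detect,q})^{V^q_{ij}}$. The entries of $A$ are assumed to lie in $[0,1]$. Mixed strategies: $X=\{x\in\mathbb{R}^m:x\ge0,\sum_i x_i=1\}$, $Y=\{y\in\mathbb{R}^n:y\ge0,\sum_j y_j=1\}$. The defender minimizes and the intruder maximizes $x^\top Ay$. Sensor sub-game matrices: $A^q\in\mathbb{R}^{d\times n}$, $A^q_{kj}=V^q_{kj}\log(1-p_{detect,q})+c^q_k$. Distributed Weighted Majority algorithm (parameter $\beta$, $T$ iterations). Initialize $\sigma^q_1(\theta_k)=1/|\Theta|$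 for all $q,k$, so that $w_1(i)=1/|I|$. For $t=1,\dots,T$: (1) $x_t(i)=w_t(i)/\sum_{i'\in I}w_t(i')$ for all $i\in I$; (2) $y_t\in\arg\max_{y\in Y}x_t^\top A y$; (3) for each sensor $s_q$ and orientation $\theta_k$, the loss is $\ell^q_t(\theta_k)=\sum_{j\in J}A^q_{kj}y_t(j)-\frac1p\sum_{j\in J}r_jy_t(j)$; (4) $\sigma^q_{t+1}(\theta_k)=\sigma^q_t(\theta_k)\,\beta^{\ell^q_t(\theta_k)}$ for all $q,k$; (5) $w_{t+1}(i)=\prod_{q=1}^p\sigma^q_{t+1}(\theta_{k_{q,i}})$ for all $i\in I$. It returns $\{x_1,\dots,x_T\}$ and $\{y_1,\dots,y_T\}$. *)

theory Defs
  imports "HOL-Analysis.Analysis" "Graph_Theory.Digraph" "Graph_Theory.Vertex_Walk"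
begin

text \<open>
  Sensors, orientations and intruder paths are indexed by finite types \<open>'s\<close>, \<open>'k\<close> and \<open>'j\<close>, so
  that \<open>p = CARD('s)\<close>, \<open>d = CARD('k)\<close> and \<open>n = CARD('j)\<close> are arbitrary positive numbers. A joint
  orientation is a function \<open>i :: 's \<Rightarrow> 'k\<close>; the type \<open>'s \<Rightarrow> 'k\<close> is itself finite, with
  \<open>m = d ^ p\<close> elements, and indexes the rows of the payoff matrix.

  The finite graph is a finite digraph (an undirected graph being a symmetric one). An intruder
  path is a vertex list following its arcs; repeated vertices are not excluded.
\<close>

locale intrusion_game = fin_digraph G
  for G :: "('v, 'e) pre_digraph" +
  fixes cover :: "'s::finite \<Rightarrow> 'k::finite \<Rightarrow> 'v set"
    and route :: "'j::finite \<Rightarrow> 'v list"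
    and p_detect p_min p_max :: "'s \<Rightarrow> real"
    and c :: "'s \<Rightarrow> 'k \<Rightarrow> real"
    and r :: "'j \<Rightarrow> real"
  assumes cover_subset: "cover q k \<subseteq> verts G"
    and route_vwalk: "vwalk (route j) G"
    and p_min_pos: "0 < p_min q"
    and p_min_less_p_max: "p_min q < p_max q"
    and p_max_less_1: "p_max q < 1"
    and p_detect_range: "p_detect q \<in> {p_min q..p_max q}"
    and orientation_cost_nonneg: "0 \<le> c q k"
    and path_cost_nonneg: "0 \<le> r j"

definition covered_nodes ::
  "('s \<Rightarrow> 'k \<Rightarrow> 'v set) \<Rightarrow> ('j \<Rightarrow> 'v list) \<Rightarrow> 's \<Rightarrow> 'k \<Rightarrow> 'j \<Rightarrow> nat" where
  "covered_nodes cover route q k j = card (set (route j) \<inter> cover q k)"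

definition p_miss ::
  "('s::finite \<Rightarrow> 'k \<Rightarrow> 'v set) \<Rightarrow> ('j \<Rightarrow> 'v list) \<Rightarrow> ('s \<Rightarrow> real) \<Rightarrow> ('s \<Rightarrow> 'k) \<Rightarrow> 'j \<Rightarrow> real" where
  "p_miss cover route p_detect i j =
     (\<Prod>q\<in>UNIV. (1 - p_detect q) ^ covered_nodes cover route q (i q) j)"

definition joint_cost :: "('s::finite \<Rightarrow> 'k \<Rightarrow> real) \<Rightarrow> ('s \<Rightarrow> 'k) \<Rightarrow> real" where
  "joint_cost c i = (\<Sum>q\<in>UNIV. c q (i q))"

definition payoff_matrix ::
  "('s::finite \<Rightarrow> 'k::finite \<Rightarrow> 'v set) \<Rightarrow> ('j::finite \<Rightarrow> 'v list) \<Rightarrow> ('s \<Rightarrow> real) \<Rightarrow>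
   ('s \<Rightarrow> 'k \<Rightarrow> real) \<Rightarrow> ('j \<Rightarrow> real) \<Rightarrow> real ^ 'j ^ ('s \<Rightarrow> 'k)" where
  "payoff_matrix cover route p_detect c r =
     (\<chi> i j. ln (p_miss cover route p_detect i j) + joint_cost c i - r j)"

definition sensor_matrix ::
  "('s \<Rightarrow> 'k::finite \<Rightarrow> 'v set) \<Rightarrow> ('j::finite \<Rightarrow> 'v list) \<Rightarrow> ('s \<Rightarrow> real) \<Rightarrow>
   ('s \<Rightarrow> 'k \<Rightarrow> real) \<Rightarrow> 's \<Rightarrow> real ^ 'j ^ 'k" where
  "sensor_matrix cover route p_detect c q =
     (\<chi> k j. real (covered_nodes cover route q k j) * ln (1 - p_detect q) + c q k)"

definition mixed_strategies :: "(real ^ 'n) set" where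
  "mixed_strategies = {x. (\<forall>i. 0 \<le> x $ i) \<and> (\<Sum>i\<in>UNIV. x $ i) = 1}"

definition game_value :: "real ^ 'n ^ 'm \<Rightarrow> real" where
  "game_value A = (INF x\<in>mixed_strategies. SUP y\<in>mixed_strategies. x \<bullet> (A *v y))"

definition sensor_loss ::
  "('s::finite \<Rightarrow> real ^ 'j ^ 'k) \<Rightarrow> ('j \<Rightarrow> real) \<Rightarrow> real ^ 'j \<Rightarrow> 's \<Rightarrow> 'k \<Rightarrow> real" where
  "sensor_loss As r y q k =
     (\<Sum>j\<in>UNIV. As q $ k $ j * y $ j) - 1 / real CARD('s) * (\<Sum>j\<in>UNIV. r j * y $ j)"

text \<open>
  The intruder's best response \<open>y t\<close> need not be unique, so the algorithm is the relation between its
  parameters and the sequences it may produce; rounds are numbered from 1.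
\<close>

definition dwm_run ::
  "real ^ 'j ^ ('s::finite \<Rightarrow> 'k::finite) \<Rightarrow> ('s \<Rightarrow> real ^ 'j ^ 'k) \<Rightarrow> ('j \<Rightarrow> real) \<Rightarrow> real \<Rightarrow> nat \<Rightarrow>
   (nat \<Rightarrow> 's \<Rightarrow> 'k \<Rightarrow> real) \<Rightarrow> (nat \<Rightarrow> ('s \<Rightarrow> 'k) \<Rightarrow> real) \<Rightarrow>
   (nat \<Rightarrow> real ^ ('s \<Rightarrow> 'k)) \<Rightarrow> (nat \<Rightarrow> real ^ 'j) \<Rightarrow> bool" where
  "dwm_run A As r \<beta> T \<sigma> w x y \<longleftrightarrow>
     (\<forall>q k. \<sigma> 1 q k = 1 / real CARD('k)) \<and>
     (\<forall>i. w 1 i = 1 / real CARD('s \<Rightarrow> 'k)) \<and>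
     (\<forall>t\<in>{1..T}.
        (\<forall>i. x t $ i = w t i / (\<Sum>i'\<in>UNIV. w t i')) \<and>
        is_arg_max (\<lambda>y'. x t \<bullet> (A *v y')) (\<lambda>y'. y' \<in> mixed_strategies) (y t) \<and>
        (\<forall>q k. \<sigma> (t + 1) q k = \<sigma> t q k * \<beta> powr sensor_loss As r (y t) q k) \<and>
        (\<forall>i. w (t + 1) i = (\<Prod>q\<in>UNIV. \<sigma> (t + 1) q (i q))))"

text \<open>The infimum and the suprema in \<^const>\<open>game_value\<close> are a minimum and maxima.\<close>

lemma compact_mixed_strategies: "compact (mixed_strategies :: (real ^ 'n) set)"
proof -
  have "closed (mixed_strategies :: (real ^ 'n) set)"
  proof -
    have "mixed_strategies = (\<Inter>i. {x :: real ^ 'n. 0 \<le> x $ i}) \<inter> {x. (\<Sum>i\<in>UNIV. x $ i) = 1}"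
      by (auto simp: mixed_strategies_def)
    moreover have "closed {x :: real ^ 'n. (\<Sum>i\<in>UNIV. x $ i) = 1}"
      by (intro closed_Collect_eq continuous_intros)
    moreover have "closed (\<Inter>i. {x :: real ^ 'n. 0 \<le> x $ i})"
      by (intro closed_INT ballI closed_Collect_le continuous_intros)
    ultimately show ?thesis by (metis closed_Int)
  qed
  moreover have "bounded (mixed_strategies :: (real ^ 'n) set)"
  proof (rule boundedI)
    fix x :: "real ^ 'n" assume x: "x \<in> mixed_strategies"
    have "norm x \<le> (\<Sum>i\<in>UNIV. \<bar>x $ i\<bar>)" by (rule norm_le_l1_cart)
    also have "\<dots> = 1" using x by (simp add: mixed_strategies_def)
    finally show "norm x \<le> 1" .
  qed
  ultimately show ?thesis by (simp add: compact_eq_bounded_closed)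
qed

lemma mixed_strategies_nonempty: "(mixed_strategies :: (real ^ 'n) set) \<noteq> {}"
proof -
  have "(\<chi> i. 1 / real CARD('n)) \<in> (mixed_strategies :: (real ^ 'n) set)"
    by (simp add: mixed_strategies_def)
  then show ?thesis by blast
qed

lemma best_response_attained:
  fixes A :: "real ^ 'n ^ 'm"
  obtains y where "y \<in> mixed_strategies"
    and "x \<bullet> (A *v y) = (SUP y\<in>mixed_strategies. x \<bullet> (A *v y))"
    and "\<And>y'. y' \<in> mixed_strategies \<Longrightarrow> x \<bullet> (A *v y') \<le> x \<bullet> (A *v y)"
proof -
  have "continuous_on mixed_strategies (\<lambda>y. x \<bullet> (A *v y))"
    by (intro continuous_intros linear_continuous_on) auto
  from continuous_attains_sup[OF compact_mixed_strategies mixed_strategies_nonempty this]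
  obtain y where y: "y \<in> mixed_strategies"
    "\<And>y'. y' \<in> mixed_strategies \<Longrightarrow> x \<bullet> (A *v y') \<le> x \<bullet> (A *v y)" by blast
  moreover have "x \<bullet> (A *v y) = (SUP y\<in>mixed_strategies. x \<bullet> (A *v y))"
    by (rule sym, rule cSup_eq_maximum) (use y in auto)
  ultimately show ?thesis using that by blast
qed

lemma game_value_attained:
  fixes A :: "real ^ 'n ^ 'm"
  obtains x where "x \<in> mixed_strategies"
    and "(SUP y\<in>mixed_strategies. x \<bullet> (A *v y)) = game_value A"
    and "\<And>x'. x' \<in> mixed_strategies \<Longrightarrow>
      (SUP y\<in>mixed_strategies. x \<bullet> (A *v y)) \<le> (SUP y\<in>mixed_strategies. x' \<bullet> (A *v y))"
proof -
  let ?g = "\<lambda>x. SUP y\<in>mixed_strategies. x \<bullet> (A *v y)"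
  have "compact ((\<lambda>y. A *v y) ` mixed_strategies)"
    by (intro compact_continuous_image compact_mixed_strategies linear_continuous_on) auto
  then obtain B where B: "\<And>y. y \<in> mixed_strategies \<Longrightarrow> norm (A *v y) \<le> B"
    unfolding compact_eq_bounded_closed bounded_iff by auto
  have "0 \<le> B" using B mixed_strategies_nonempty norm_ge_zero order_trans by blast
  have half: "?g x \<le> ?g x' + B * dist x x'" for x x'
  proof -
    obtain y where y: "y \<in> mixed_strategies" "x \<bullet> (A *v y) = ?g x"
      using best_response_attained[where A = A and x = x] by metis
    obtain y' where y': "x' \<bullet> (A *v y') = ?g x'"
      "\<And>z. z \<in> mixed_strategies \<Longrightarrow> x' \<bullet> (A *v z) \<le> x' \<bullet> (A *v y')"
      using best_response_attained[where A = A and x = x'] by metis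
    have "?g x = x' \<bullet> (A *v y) + (x - x') \<bullet> (A *v y)"
      using y by (simp add: inner_diff_left)
    also have "x' \<bullet> (A *v y) \<le> ?g x'" using y y' by metis
    also have "(x - x') \<bullet> (A *v y) \<le> norm (x - x') * norm (A *v y)"
      by (rule norm_cauchy_schwarz)
    also have "\<dots> \<le> norm (x - x') * B" by (intro mult_left_mono B y) auto
    finally show ?thesis by (simp add: dist_norm mult.commute)
  qed
  have "B-lipschitz_on mixed_strategies ?g"
  proof (rule lipschitz_onI[OF _ \<open>0 \<le> B\<close>])
    fix x x' :: "real ^ 'm"
    show "dist (?g x) (?g x') \<le> B * dist x x'"
      using half[of x x'] half[of x' x] by (simp add: dist_real_def dist_commute abs_le_iff)
  qed
  then have "continuous_on mixed_strategies ?g" by (rule lipschitz_on_continuous_on)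
  from continuous_attains_inf[OF compact_mixed_strategies mixed_strategies_nonempty this]
  obtain x where x: "x \<in> mixed_strategies" "\<And>x'. x' \<in> mixed_strategies \<Longrightarrow> ?g x \<le> ?g x'"
    by blast
  moreover have "?g x = game_value A"
    unfolding game_value_def by (rule sym, rule cInf_eq_minimum) (use x in auto)
  ultimately show ?thesis using that by blast
qed

end

theory Submission
  imports Defs
begin

text \<open>
  The logarithm turns the product defining \<^const>\<open>p_miss\<close> into a sum over the sensors, so the sensor
  losses of a joint orientation \<open>i\<close> add up to the entry \<open>(A y\<^sub>t)\<^sub>i\<close>, and the product weights \<open>w\<^sub>t\<close>
  evolve exactly as in the Hedge algorithm on the \<open>d ^ p\<close> rows of \<open>A\<close> with losses \<open>(A y\<^sub>t)\<^sub>i \<in> [0,1]\<close>.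
  The Hedge regret bound with the tuned \<open>\<beta>\<close> gives
  \<open>avg\<^sub>t x\<^sub>t \<bullet> A y\<^sub>t \<le> min\<^sub>i (A ybar)\<^sub>i + \<epsilon>\<close>. As \<open>y\<^sub>t\<close> is a best response to \<open>x\<^sub>t\<close>, the left-hand side is
  at least both the game value and \<open>max\<^sub>y xbar \<bullet> A y\<close>; weak duality then yields both inequalities.
\<close>

section \<open>Scalar inequalities and the Hedge regret bound\<close>

text \<open>The difference of the two sides vanishes at 1 and has derivative
  \<open>(1 - 1/v)^2 / 2\<close>. Taken at \<open>u = 1/b\<close>, it controls \<open>- ln b\<close>
  when the parameter is tuned.\<close>

lemma ln_le_half_diff_inverse:
  fixes u :: real
  assumes "1 \<le> u"
  shows "ln u \<le> (u - 1 / u) / 2"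
proof -
  let ?f = "\<lambda>u::real. (u - 1 / u) / 2 - ln u"
  have "?f 1 \<le> ?f u"
  proof (rule DERIV_nonneg_imp_nondecreasing[OF assms])
    fix v :: real
    assume v: "1 \<le> v" "v \<le> u"
    have "(?f has_real_derivative (1 - 1 / v)\<^sup>2 / 2) (at v)"
      using v by (auto intro!: derivative_eq_intros simp: power2_eq_square field_simps)
    then show "\<exists>D. (?f has_real_derivative D) (at v) \<and> 0 \<le> D"
      by (intro exI conjI) auto
  qed
  then show ?thesis by simp
qed

text \<open>By convexity, \<open>b powr a\<close> as a function of \<open>a\<close> lies below its
  chord on [0,1]; this is weighted AM-GM for \<open>b\<close> and 1 with weights \<open>a\<close>
  and \<open>1 - a\<close>.\<close>

lemma powr_le_linear:
  fixes b a :: real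
  assumes "0 < b" "0 \<le> a" "a \<le> 1"
  shows "b powr a \<le> 1 - (1 - b) * a"
  using Youngs_inequality_0[of a "1 - a" b 1] assms by (simp add: algebra_simps)

text \<open>Potential argument with the total weight \<open>W\<close>: a round with weighted mean
  loss \<open>m t\<close> multiplies it by at most \<open>1 - (1 - b) * m t\<close>, hence by at
  most \<open>exp (- (1 - b) * m t)\<close>. The final total is at least the single weight of
  \<open>k\<close>; taking logarithms compares the two estimates.\<close>

lemma hedge_regret:
  fixes w a :: "nat \<Rightarrow> 'i::finite \<Rightarrow> real"
  assumes b: "0 < b" "b \<le> 1"
    and w1: "\<And>i. w 1 i = 1 / real CARD('i)"
    and wS: "\<And>t i. t \<in> {1..T} \<Longrightarrow> w (t + 1) i = w t i * b powr a t i"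
    and a: "\<And>t i. t \<in> {1..T} \<Longrightarrow> a t i \<in> {0..1}"
  shows "(1 - b) * (\<Sum>t = 1..T. (\<Sum>i\<in>UNIV. w t i * a t i) / (\<Sum>i\<in>UNIV. w t i))
    \<le> ln (real CARD('i)) - ln b * (\<Sum>t = 1..T. a t k)"
proof -
  define W where "W t = (\<Sum>i\<in>UNIV. w t i)" for t
  define m where "m t = (\<Sum>i\<in>UNIV. w t i * a t i) / W t" for t
  \<comment> \<open>Index \<open>n + 1\<close> is the state after \<open>n\<close> rounds. The
    closed form of the weights is carried along because it gives their positivity inside the
    induction and the exact weight of \<open>k\<close> at the end.\<close>
  have main: "(\<forall>i. w (n + 1) i = 1 / real CARD('i) * b powr (\<Sum>t = 1..n. a t i)) \<and>
      W (n + 1) \<le> exp (- (1 - b) * (\<Sum>t = 1..n. m t))" if "n \<le> T" for n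
    using that
  proof (induction n)
    case 0
    then show ?case using w1 b by (simp add: W_def)
  next
    case (Suc n)
    then have IH: "\<And>i. w (n + 1) i = 1 / real CARD('i) * b powr (\<Sum>t = 1..n. a t i)"
      "W (n + 1) \<le> exp (- (1 - b) * (\<Sum>t = 1..n. m t))" and n: "n + 1 \<in> {1..T}"
      by auto
    have pos: "0 < w (n + 1) i" for i unfolding IH(1) using b by simp
    have Wpos: "0 < W (n + 1)" unfolding W_def using pos by (intro sum_pos) auto
    have "W (Suc n + 1) = (\<Sum>i\<in>UNIV. w (n + 1) i * b powr a (n + 1) i)"
      using wS[OF n] by (simp add: W_def)
    also have "\<dots> \<le> (\<Sum>i\<in>UNIV. w (n + 1) i * (1 - (1 - b) * a (n + 1) i))"
      using pos a[OF n] b by (intro sum_mono mult_left_mono powr_le_linear) (auto intro: less_imp_le)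
    also have "\<dots> = W (n + 1) - (1 - b) * (\<Sum>i\<in>UNIV. w (n + 1) i * a (n + 1) i)"
      by (simp add: W_def algebra_simps sum_subtractf sum.distrib sum_distrib_left)
    also have "\<dots> = W (n + 1) * (1 + - (1 - b) * m (n + 1))"
    proof -
      have "(\<Sum>i\<in>UNIV. w (n + 1) i * a (n + 1) i) = W (n + 1) * m (n + 1)"
        using Wpos by (simp add: m_def)
      then show ?thesis by (simp add: algebra_simps)
    qed
    also have "\<dots> \<le> W (n + 1) * exp (- (1 - b) * m (n + 1))"
      using Wpos by (intro mult_left_mono exp_ge_add_one_self) auto
    also have "\<dots> \<le> exp (- (1 - b) * (\<Sum>t = 1..n. m t)) * exp (- (1 - b) * m (n + 1))"
      using IH(2) by (intro mult_right_mono) auto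
    also have "\<dots> = exp (- (1 - b) * (\<Sum>t = 1..Suc n. m t))"
      by (simp add: exp_add[symmetric] algebra_simps)
    finally show ?case
      using wS[OF n] IH(1) by (simp add: powr_add)
  qed
  have pos: "0 < w (T + 1) i" for i using main[of T] b by simp
  have "w (T + 1) k \<le> W (T + 1)"
    unfolding W_def using pos by (intro member_le_sum) (auto intro: less_imp_le)
  also have "\<dots> \<le> exp (- (1 - b) * (\<Sum>t = 1..T. m t))" using main by blast
  finally have "ln (w (T + 1) k) \<le> - (1 - b) * (\<Sum>t = 1..T. m t)"
    using pos by (metis ln_exp ln_le_cancel_iff exp_gt_zero)
  moreover have "ln (w (T + 1) k) = ln b * (\<Sum>t = 1..T. a t k) - ln (real CARD('i))"
    using main[of T] b by (simp add: ln_mult ln_div ln_powr mult.commute)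
  ultimately show ?thesis by (simp add: m_def W_def algebra_simps)
qed

text \<open>With \<open>z = sqrt (2 * N / L)\<close> and \<open>b = 1 / (1 + z)\<close>, dividing
  the regret bound by \<open>1 - b > 0\<close> yields
  \<open>S \<le> (1 + z / 2) * M + (1 + 1 / z) * N\<close>.\<close>

lemma hedge_tuning:
  fixes S M L N :: real
  assumes b: "b = inverse (1 + sqrt (2 * N / L))"
    and L: "0 < L" "M \<le> L" "0 \<le> M" and N: "0 < N"
    and regret: "(1 - b) * S \<le> N - ln b * M"
  shows "S \<le> M + sqrt (2 * L * N) + N"
proof -
  define z where "z = sqrt (2 * N / L)"
  have z: "0 < z" and z2: "z * z = 2 * N / L" using L N by (auto simp: z_def)
  have bz: "b = 1 / (1 + z)" using b by (simp add: z_def inverse_eq_divide)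
  have Lz: "L * z = sqrt (2 * L * N)"
  proof (rule real_sqrt_unique[symmetric])
    show "(L * z)\<^sup>2 = 2 * L * N"
      using L by (simp add: power2_eq_square z2 mult.assoc mult.left_commute[of z])
  qed (use L z in auto)
  \<comment> \<open>The choice of \<open>z\<close> balances the two error terms: each is half of
    \<open>sqrt (2 * L * N)\<close>.\<close>
  have Nz: "N / z = L * z / 2" using z2 z L by (simp add: field_simps)
  have "- ln b \<le> ((1 + z) - 1 / (1 + z)) / 2"
    using ln_le_half_diff_inverse[of "1 + z"] z by (simp add: bz ln_div)
  also have "\<dots> = (1 - b) * (1 + z / 2)" using z by (simp add: bz field_simps)
  finally have "- ln b * M \<le> (1 - b) * (1 + z / 2) * M"
    using L(3) by (rule mult_right_mono)
  moreover have "N = (1 - b) * (N + N / z)"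
  proof -
    have "(1 - b) * (1 + 1 / z) = 1"
      using z add_pos_pos[OF z mult_pos_pos[OF z z]] by (simp add: bz field_simps)
    then have "N = (1 - b) * (1 + 1 / z) * N" by simp
    then show ?thesis by (simp add: algebra_simps)
  qed
  ultimately have "(1 - b) * S \<le> (1 - b) * ((1 + z / 2) * M + (N + N / z))"
    using regret by (simp add: algebra_simps)
  then have "S \<le> (1 + z / 2) * M + (N + N / z)" using z by (simp add: bz)
  \<comment> \<open>Only the excess \<open>z / 2 * M\<close> is estimated through \<open>L\<close>,
    so \<open>M\<close> itself keeps coefficient 1.\<close>
  also have "(1 + z / 2) * M \<le> M + L * z / 2"
    using mult_left_mono[OF L(2), of "z / 2"] z by (simp add: algebra_simps)
  finally show ?thesis by (simp add: Nz flip: Lz)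
qed

section \<open>Averaged strategies and the game value\<close>

lemma mixed_strategies_average:
  fixes x :: "nat \<Rightarrow> real ^ 'n"
  assumes "1 \<le> T" "\<And>t. t \<in> {1..T} \<Longrightarrow> x t \<in> mixed_strategies"
  shows "(1 / real T) *\<^sub>R (\<Sum>t = 1..T. x t) \<in> mixed_strategies"
proof -
  have "(\<Sum>i\<in>UNIV. \<Sum>t = 1..T. x t $ i) = (\<Sum>t = 1..T. \<Sum>i\<in>UNIV. x t $ i)"
    by (rule sum.swap)
  also have "\<dots> = real T"
    using assms by (simp add: mixed_strategies_def)
  finally show ?thesis
    using assms by (auto simp: mixed_strategies_def intro!: divide_nonneg_nonneg sum_nonneg simp flip: sum_divide_distrib)
qed

lemma mixed_strategy_average_ge:
  fixes x v :: "real ^ 'n"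
  assumes "x \<in> mixed_strategies" "\<And>i. b \<le> v $ i"
  shows "b \<le> x \<bullet> v"
proof -
  have "b = (\<Sum>i\<in>UNIV. x $ i * b)"
    using assms by (simp add: mixed_strategies_def flip: sum_distrib_right)
  also have "\<dots> \<le> x \<bullet> v"
    using assms by (auto simp: inner_vec_def mixed_strategies_def intro!: sum_mono mult_left_mono)
  finally show ?thesis .
qed

text \<open>The bound against pure rows extends by averaging to every mixed \<open>z\<close>, so
  \<open>?avg - e \<le> z \<bullet> (A *v ybar)\<close>. Taking \<open>z = xbar\<close> gives the
  lower estimate; taking for \<open>z\<close> the minimax strategy \<open>x'\<close>, which concedes
  at most the value against \<open>ybar\<close>, gives the upper one.\<close>

lemma average_best_response_value:
  fixes A :: "real ^ 'n ^ 'm" and x :: "nat \<Rightarrow> real ^ 'm" and y :: "nat \<Rightarrow> real ^ 'n"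
  assumes T: "1 \<le> T"
    and x: "\<And>t. t \<in> {1..T} \<Longrightarrow> x t \<in> mixed_strategies"
    and y: "\<And>t. t \<in> {1..T} \<Longrightarrow> y t \<in> mixed_strategies"
    and best: "\<And>t z. t \<in> {1..T} \<Longrightarrow> z \<in> mixed_strategies \<Longrightarrow> x t \<bullet> (A *v z) \<le> x t \<bullet> (A *v y t)"
    and xbar: "xbar = (1 / real T) *\<^sub>R (\<Sum>t = 1..T. x t)"
    and ybar: "ybar = (1 / real T) *\<^sub>R (\<Sum>t = 1..T. y t)"
    and regret: "\<And>i. (\<Sum>t = 1..T. x t \<bullet> (A *v y t)) / real T \<le> (A *v ybar) $ i + e"
  shows "\<bar>xbar \<bullet> (A *v ybar) - game_value A\<bar> \<le> e"
proof -
  let ?avg = "(\<Sum>t = 1..T. x t \<bullet> (A *v y t)) / real T"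
  have xb: "xbar \<in> mixed_strategies" and yb: "ybar \<in> mixed_strategies"
    unfolding xbar ybar using mixed_strategies_average[OF T] x y by blast+
  obtain x' where x': "x' \<in> mixed_strategies"
    and val: "(SUP y\<in>mixed_strategies. x' \<bullet> (A *v y)) = game_value A"
    and opt: "\<And>z. z \<in> mixed_strategies \<Longrightarrow>
      (SUP y\<in>mixed_strategies. x' \<bullet> (A *v y)) \<le> (SUP y\<in>mixed_strategies. z \<bullet> (A *v y))"
    using game_value_attained[where A = A] by blast
  have "game_value A \<le> x t \<bullet> (A *v y t)" if t: "t \<in> {1..T}" for t
  proof -
    have "game_value A \<le> (SUP y\<in>mixed_strategies. x t \<bullet> (A *v y))"
      using opt[OF x[OF t]] val by simp
    also have "\<dots> \<le> x t \<bullet> (A *v y t)"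
      using best[OF t] by (intro cSUP_least mixed_strategies_nonempty) auto
    finally show ?thesis .
  qed
  then have "(\<Sum>t = 1..T. game_value A) \<le> (\<Sum>t = 1..T. x t \<bullet> (A *v y t))"
    by (rule sum_mono)
  then have "game_value A \<le> ?avg" using T by (simp add: field_simps)
  moreover have "?avg - e \<le> z \<bullet> (A *v ybar)" if "z \<in> mixed_strategies" for z
    using that regret by (intro mixed_strategy_average_ge) (auto simp: algebra_simps)
  ultimately have lower: "game_value A - e \<le> xbar \<bullet> (A *v ybar)"
    and dual: "?avg - e \<le> x' \<bullet> (A *v ybar)" using xb x' by fastforce+
  \<comment> \<open>The fixed strategy \<open>ybar\<close> competes with the best response in every
    round.\<close>
  have "(\<Sum>t = 1..T. x t \<bullet> (A *v ybar)) \<le> (\<Sum>t = 1..T. x t \<bullet> (A *v y t))"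
    using best yb by (intro sum_mono) auto
  then have upper: "xbar \<bullet> (A *v ybar) \<le> ?avg"
    using T by (simp add: xbar inner_sum_left divide_right_mono)
  have "x' \<bullet> (A *v ybar) \<le> game_value A"
    using best_response_attained[where A = A and x = x'] yb val by metis
  with lower dual upper show ?thesis by linarith
qed

section \<open>The distributed weights as Hedge weights on joint orientations\<close>

text \<open>All factors of \<open>p_miss\<close> are positive, so its logarithm splits over the
  sensors. Each sensor is credited the share \<open>1 / CARD('s)\<close> of the path cost, and the
  shares add up to one full \<open>r j\<close>.\<close>

lemma payoff_eq_sum_sensor_loss:
  fixes cover :: "'s::finite \<Rightarrow> 'k::finite \<Rightarrow> 'v set" and route :: "'j::finite \<Rightarrow> 'v list"
  assumes "\<And>q. p_detect q < 1"
  shows "(payoff_matrix cover route p_detect c r *v y) $ i =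
    (\<Sum>q\<in>UNIV. sensor_loss (sensor_matrix cover route p_detect c) r y q (i q))"
proof -
  have ln_miss: "ln (p_miss cover route p_detect i j) =
      (\<Sum>q\<in>UNIV. real (covered_nodes cover route q (i q) j) * ln (1 - p_detect q))" for j
  proof -
    have pos: "0 < 1 - p_detect q" for q using assms[of q] by simp
    then have "1 - p_detect q \<noteq> 0" for q by (metis less_irrefl)
    with pos show ?thesis
      unfolding p_miss_def by (subst ln_prod) (simp_all add: ln_realpow del: right_minus_eq)
  qed
  have "(\<Sum>q\<in>UNIV. sensor_loss (sensor_matrix cover route p_detect c) r y q (i q)) =
      (\<Sum>q\<in>UNIV. \<Sum>j\<in>UNIV. sensor_matrix cover route p_detect c q $ i q $ j * y $ j)
      - (\<Sum>j\<in>UNIV. r j * y $ j)"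
    by (simp add: sensor_loss_def sum_subtractf)
  also have "\<dots> = (\<Sum>j\<in>UNIV. (\<Sum>q\<in>UNIV. sensor_matrix cover route p_detect c q $ i q $ j) * y $ j
      - r j * y $ j)"
    by (subst sum.swap) (simp add: sum_subtractf sum_distrib_right)
  also have "\<dots> = (payoff_matrix cover route p_detect c r *v y) $ i"
    by (simp add: matrix_vector_mult_def payoff_matrix_def sensor_matrix_def ln_miss
        joint_cost_def sum.distrib algebra_simps)
  finally show ?thesis by simp
qed

theorem theorem4:
  fixes G :: "('v, 'e) pre_digraph"
    and cover :: "'s::finite \<Rightarrow> 'k::finite \<Rightarrow> 'v set"
    and route :: "'j::finite \<Rightarrow> 'v list"
    and p_detect p_min p_max :: "'s \<Rightarrow> real"
    and c :: "'s \<Rightarrow> 'k \<Rightarrow> real"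
    and r :: "'j \<Rightarrow> real"
    and A :: "real ^ 'j ^ ('s \<Rightarrow> 'k)"
    and As :: "'s \<Rightarrow> real ^ 'j ^ 'k"
    and T :: nat
    and \<beta> L \<epsilon> :: real
    and \<sigma> :: "nat \<Rightarrow> 's \<Rightarrow> 'k \<Rightarrow> real"
    and w :: "nat \<Rightarrow> ('s \<Rightarrow> 'k) \<Rightarrow> real"
    and x :: "nat \<Rightarrow> real ^ ('s \<Rightarrow> 'k)"
    and y :: "nat \<Rightarrow> real ^ 'j"
    and xbar :: "real ^ ('s \<Rightarrow> 'k)"
    and ybar :: "real ^ 'j"
  assumes "intrusion_game G cover route p_detect p_min p_max c r"
    and "A = payoff_matrix cover route p_detect c r"
    and "\<forall>i j. A $ i $ j \<in> {0..1}"
    and "As = sensor_matrix cover route p_detect c"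
    and "T \<ge> 1"
    and "L > 0"
    and "\<beta> = inverse (1 + sqrt (2 * real CARD('s) * ln (real CARD('k)) / L))"
    and "dwm_run A As r \<beta> T \<sigma> w x y"
    and "L \<ge> (MIN i\<in>UNIV. \<Sum>t = 1..T. \<Sum>q\<in>UNIV. sensor_loss As r (y t) q (i q))"
    and "xbar = (1 / real T) *\<^sub>R (\<Sum>t = 1..T. x t)"
    and "ybar = (1 / real T) *\<^sub>R (\<Sum>t = 1..T. y t)"
    and "\<epsilon> = sqrt (2 * L * real CARD('s) * ln (real CARD('k))) / real T
              + real CARD('s) * ln (real CARD('k)) / real T"
  shows "xbar \<in> mixed_strategies \<and> ybar \<in> mixed_strategies \<and>
         \<bar>xbar \<bullet> (A *v ybar) - game_value A\<bar> \<le> \<epsilon>"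
proof -
  interpret intrusion_game G cover route p_detect p_min p_max c r by fact
  have p1: "p_detect q < 1" for q
    using p_detect_range[of q] p_max_less_1[of q] by simp
  have loss: "(\<Sum>q\<in>UNIV. sensor_loss As r z q (i q)) = (A *v z) $ i" for z i
    using payoff_eq_sum_sensor_loss[of p_detect cover route c r z i] p1 assms(2,4) by simp
  have T: "1 \<le> T" and L: "0 < L" by fact+
  \<comment> \<open>Hedge pays the logarithm of the number of rows; as there are
    \<open>d ^ p\<close> of them, this is only \<open>p * ln d\<close>.\<close>
  define N where "N = ln (real CARD('s \<Rightarrow> 'k))"
  have N: "N = real CARD('s) * ln (real CARD('k))"
    by (simp add: N_def card_fun ln_realpow)
  have N0: "0 \<le> N" by (simp add: N_def)
  have \<beta>: "\<beta> = inverse (1 + sqrt (2 * N / L))" using assms(7) by (simp add: N mult.assoc)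
  have sq: "0 \<le> sqrt (2 * N / L)" using N0 L by simp
  have \<beta>0: "0 < \<beta>" "\<beta> \<le> 1" using sq unfolding \<beta> inverse_le_1_iff inverse_positive_iff_positive by linarith+
  have \<sigma>1: "\<sigma> 1 q k = 1 / real CARD('k)" and w1: "w 1 i = 1 / real CARD('s \<Rightarrow> 'k)" for q k i
    using assms(8) by (auto simp: dwm_run_def)
  have xt: "x t $ i = w t i / (\<Sum>i'\<in>UNIV. w t i')"
    and arg: "is_arg_max (\<lambda>y'. x t \<bullet> (A *v y')) (\<lambda>y'. y' \<in> mixed_strategies) (y t)"
    and \<sigma>S: "\<sigma> (t + 1) q k = \<sigma> t q k * \<beta> powr sensor_loss As r (y t) q k"
    and wS: "w (t + 1) i = (\<Prod>q\<in>UNIV. \<sigma> (t + 1) q (i q))"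
    if "t \<in> {1..T}" for t q k i
    using assms(8) that unfolding dwm_run_def by blast+
  have y: "y t \<in> mixed_strategies" if "t \<in> {1..T}" for t
    using arg[OF that] by (simp add: is_arg_max_def)
  have best: "x t \<bullet> (A *v z) \<le> x t \<bullet> (A *v y t)" if "t \<in> {1..T}" "z \<in> mixed_strategies" for t z
    using arg[OF that(1)] that(2) by (auto simp: is_arg_max_linorder)
  \<comment> \<open>The update rule gives the product form only from round 2 on; in round 1 it holds
    because the uniform weight on joint orientations is the product of the uniform sensor
    weights.\<close>
  have w_prod: "w t i = (\<Prod>q\<in>UNIV. \<sigma> t q (i q))" if "t \<in> {1..T}" for t i
  proof (cases "t = 1")
    case True
    show ?thesis unfolding True \<sigma>1 w1 by (simp add: card_fun power_one_over)
  next
    case False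
    with that have "t - 1 \<in> {1..T}" "t - 1 + 1 = t" by auto
    with wS show ?thesis by metis
  qed
  \<comment> \<open>Multiplying the sensor updates adds their exponents, and the summed losses are
    one entry of \<open>A *v y t\<close>: this is the Hedge update.\<close>
  have w_step: "w (t + 1) i = w t i * \<beta> powr ((A *v y t) $ i)" if "t \<in> {1..T}" for t i
    unfolding wS[OF that] \<sigma>S[OF that] w_prod[OF that] loss[symmetric]
    using \<beta>0 by (simp add: prod.distrib powr_sum)
  \<comment> \<open>Each entry is an average of a row of \<open>A\<close> with weights
    \<open>y t\<close>; the upper bound comes from the negated row.\<close>
  have Ay: "(A *v y t) $ i \<in> {0..1}" if "t \<in> {1..T}" for t i
  proof -
    have "0 \<le> y t \<bullet> (A $ i)"
      using assms(3) by (intro mixed_strategy_average_ge[OF y[OF that]]) auto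
    moreover have "-1 \<le> y t \<bullet> (- (A $ i))"
      using assms(3) by (intro mixed_strategy_average_ge[OF y[OF that]]) auto
    ultimately show ?thesis by (simp add: matrix_vector_mul_component inner_commute)
  qed
  have w_pos: "0 < w t i" if "t \<in> {1..T}" for t i
  proof -
    have "t \<le> T \<Longrightarrow> 0 < w t i"  if "1 \<le> t" for t
      using that
    proof (induction t rule: dec_induct)
      case base
      then show ?case using w1[of i] by simp
    next
      case (step n)
      then show ?case using w_step[of n i] \<beta>0 by simp
    qed
    then show ?thesis using that by simp
  qed
  have x: "x t \<in> mixed_strategies" if "t \<in> {1..T}" for t
  proof -
    have "0 < (\<Sum>i\<in>UNIV. w t i)" using w_pos[OF that] by (intro sum_pos) auto
    then show ?thesis
      using w_pos[OF that] xt[OF that]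
      by (auto simp: mixed_strategies_def less_imp_le simp flip: sum_divide_distrib)
  qed
  define S where "S = (\<Sum>t = 1..T. x t \<bullet> (A *v y t))"
  define M where "M i = (\<Sum>t = 1..T. (A *v y t) $ i)" for i
  have S_eq: "S = (\<Sum>t = 1..T. (\<Sum>i\<in>UNIV. w t i * (A *v y t) $ i) / (\<Sum>i\<in>UNIV. w t i))"
    unfolding S_def by (intro sum.cong) (auto simp: inner_vec_def xt sum_divide_distrib)
  have regret: "(1 - \<beta>) * S \<le> N - ln \<beta> * M i" for i
    unfolding S_eq M_def N_def
    using hedge_regret[of \<beta> w T "\<lambda>t i. (A *v y t) $ i"] \<beta>0 w1 w_step Ay by blast
  \<comment> \<open>The row \<open>k\<close> is a best fixed joint orientation in hindsight; its
    loss \<open>M k\<close> is the minimum that \<open>L\<close> is assumed to dominate.\<close>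
  have "(MIN i\<in>UNIV. M i) \<in> range M" by (intro Min_in) auto
  then obtain k where k: "M k = (MIN i\<in>UNIV. M i)" by (metis imageE)
  have k_le: "M k \<le> M i" for i unfolding k by (intro Min_le) auto
  have M_le: "M k \<le> L" using assms(9) unfolding k unfolding M_def loss .
  have M0: "0 \<le> M k" using Ay by (auto simp: M_def intro!: sum_nonneg)
  have "S \<le> M k + sqrt (2 * L * N) + N"
  proof (cases "N = 0")
    case False
    then show ?thesis using hedge_tuning[OF \<beta> L M_le M0 _ regret] N0 by simp
  next
    case True
    \<comment> \<open>Here \<open>\<beta> = 1\<close> and the regret bound is void, but there is only one joint orientation.\<close>
    have "CARD('s \<Rightarrow> 'k) = 1" using True by (simp add: N_def)
    then have "(i::'s \<Rightarrow> 'k) = k" for i by (metis UNIV_I card_1_singletonE singletonD)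
    then have U: "(UNIV :: ('s \<Rightarrow> 'k) set) = {k}" by auto
    have "S = M k" unfolding S_def M_def
    proof (intro sum.cong refl)
      fix t assume "t \<in> {1..T}"
      then show "x t \<bullet> (A *v y t) = (A *v y t) $ k"
        using x[of t] by (simp add: inner_vec_def mixed_strategies_def U)
    qed
    then show ?thesis using True by simp
  qed
  moreover have "(A *v ybar) $ i = M i / real T" for i
    by (simp add: assms(11) M_def matrix_vector_mul_component inner_sum_right)
  moreover have "\<epsilon> = (sqrt (2 * L * N) + N) / real T"
    using assms(12) by (simp add: N add_divide_distrib mult.assoc)
  \<comment> \<open>Minimality of \<open>M k\<close> turns the bound against \<open>k\<close> into
    one against every row.\<close>
  ultimately have "S / real T \<le> (A *v ybar) $ i + \<epsilon>" for i
    using k_le[of i] T by (simp add: field_simps)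
  then have "\<bar>xbar \<bullet> (A *v ybar) - game_value A\<bar> \<le> \<epsilon>"
    unfolding S_def by (intro average_best_response_value[OF T x y best assms(10,11)])
  moreover have "xbar \<in> mixed_strategies" "ybar \<in> mixed_strategies"
    unfolding assms(10,11) using mixed_strategies_average[OF T] x y by blast+
  ultimately show ?thesis by blast
qed

end
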